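(* Let $p\ge 1$ be an integer. There is a constant $C>0$ depending only on $p$ such that the following holds. Let $L>0$, let $\mathcal X\subseteq\mathbb R^d$ be closed, convex and bounded with diameter $D>0$, let $F:\mathbb R^d\to\mathbb R^d$ be $(p-1)^{\text{th}}$-order $L$-smooth, and suppose the Minty condition holds: there exists $x^\star\in\mathcal X$ with $\langle F(x),x-x^\star\rangle\ge0$ for all $x\in\mathcal X$. Let $x_0\in\mathcal X$ and $\epsilon\in(0,1)$. Then there is an integer $T\ge 1$, depending only on $p,L,D,\epsilon$, with $$T\le C\,\max\Big\{1,\Big(\frac{LD^{p+1}}{\epsilon}\Big)^{\frac{2}{p}}\Big\},$$ such that every output $\hat x$ of $\mathsf{Perseus}(p,x_0,L,T,2)$ satisfies $\textsc{res}(\hat x)\le\epsilon$, where $\textsc{res}(\hat x)=\sup_{x\in\mathcal X}\langle F(\hat x),\hat x-x\rangle$. The total number of calls of the subproblem solver is equal to $T$ (or smaller if the method stops early at a solution).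
   Context: Norms are Euclidean. The diameter is $D=\max_{x,x'\in\mathcal X}\|x-x'\|$. $F$ is $(p-1)^{\text{th}}$-order $L$-smooth if it is $(p-1)$ times continuously differentiable and $\|\nabla^{(p-1)}F(x)-\nabla^{(p-1)}F(x')\|_{\mathrm{op}}\le L\|x-x'\|$ for all $x,x'\in\mathbb R^d$ (operator norm of multilinear maps; $\nabla^{(0)}F=F$). $F$ need not be monotone. For $v\in\mathcal X$ define $$F_v(x)=\sum_{j=0}^{p-1}\tfrac1{j!}\nabla^{(j)}F(v)[x-v]^j+\tfrac{5L}{(p-1)!}\|x-v\|^{p-1}(x-v)$$ (for $p=1$: $F_v(x)=F(v)+5L(x-v)$). Method $\mathsf{Perseus}(p,x_0,L,T,\mathsf{opt})$ with $\mathsf{opt}=2$. Set $s_0=0$. For $k=0,1,\dots,T-1$: (1) if $x_k$ is a solution of the VI, i.e. $\langle F(x_k),x-x_k\rangle\ge0$ for all $x\in\mathcal X$, stop and return $x_k$; (2) $v_{k+1}=\operatorname{argmax}_{v\in\mathcal X}\{\langle s_k,v-x_0\rangle-\frac12\|v-x_0\|^2\}$; (3) (one call of the subproblem solver) take any $x_{k+1}\in\mathcal X$ with $\sup_{x\in\mathcal X}\langle F_{v_{k+1}}(x_{k+1}),x_{k+1}-x\rangle\le\frac{L}{p!}\|x_{k+1}-v_{k+1}\|^{p+1}$; (4) take any $\lambda_{k+1}>0$ with $\frac1{20p-8}\le\frac{\lambda_{k+1}L\|x_{k+1}-v_{k+1}\|^{p-1}}{p!}\le\frac1{10p+2}$ (with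 the convention $t^0=1$; if $p\ge2$ and $x_{k+1}=v_{k+1}$, then $x_{k+1}$ is a solution of the VI and the method stops and returns it); (5) $s_{k+1}=s_k-\lambda_{k+1}F(x_{k+1})$. If it did not stop early, the output is $\hat x=x_{k_T}$ with $k_T\in\operatorname{argmin}_{1\le k\le T}\|x_k-v_k\|$. *)

theory Defs
  imports "HOL-Analysis.Analysis"
begin

section \<open>The spaces \<open>\<real>\<^sup>d\<close> inside one type\<close>

text \<open>
  The constant of the theorem must not depend on the dimension \<open>d\<close>, so \<open>d\<close> has to be
  quantified inside the formula and cannot be a type. All the spaces \<open>\<real>\<^sup>d\<close> are therefore realised
  inside the real inner product space \<open>rseq\<close> of finitely supported real sequences: \<open>Rd d\<close> consists
  of the sequences supported on the first \<open>d\<close> indices, and on it \<open>inner\<close> and \<open>norm\<close> are the standard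
  inner product and the Euclidean norm of \<open>\<real>\<^sup>d\<close> (lemma \<open>inner_Rd\<close>).
\<close>

typedef rseq = "{f :: nat \<Rightarrow> real. finite {i. f i \<noteq> 0}}"
  morphisms coord Abs_rseq
  by (rule exI [of _ "\<lambda>_. 0"]) simp

setup_lifting type_definition_rseq

lemma finite_coord [simp]: "finite {i. coord x i \<noteq> 0}"
  using coord [of x] by simp

instantiation rseq :: real_vector
begin

lift_definition zero_rseq :: rseq is "\<lambda>_. 0" by simp

lift_definition plus_rseq :: "rseq \<Rightarrow> rseq \<Rightarrow> rseq" is "\<lambda>f g i. f i + g i"
  by (rule rev_finite_subset, erule finite_UnI, assumption, auto)

lift_definition minus_rseq :: "rseq \<Rightarrow> rseq \<Rightarrow> rseq" is "\<lambda>f g i. f i - g i"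
  by (rule rev_finite_subset, erule finite_UnI, assumption, auto)

lift_definition uminus_rseq :: "rseq \<Rightarrow> rseq" is "\<lambda>f i. - f i" by simp

lift_definition scaleR_rseq :: "real \<Rightarrow> rseq \<Rightarrow> rseq" is "\<lambda>r f i. r * f i"
  by (erule rev_finite_subset) auto

instance
  by standard (transfer; simp add: algebra_simps)+

end

instantiation rseq :: real_inner
begin

definition inner_rseq :: "rseq \<Rightarrow> rseq \<Rightarrow> real"
  where "inner_rseq x y = (\<Sum>i | coord x i \<noteq> 0. coord x i * coord y i)"

definition norm_rseq :: "rseq \<Rightarrow> real"
  where "norm_rseq x = sqrt (inner x x)"

definition sgn_rseq :: "rseq \<Rightarrow> rseq"
  where "sgn_rseq x = x /\<^sub>R norm x"

definition dist_rseq :: "rseq \<Rightarrow> rseq \<Rightarrow> real"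
  where "dist_rseq x y = norm (x - y)"

definition uniformity_rseq :: "(rseq \<times> rseq) filter"
  where "uniformity_rseq = (INF e\<in>{0<..}. principal {(x, y). dist x y < e})"

definition open_rseq :: "rseq set \<Rightarrow> bool"
  where "open_rseq U \<longleftrightarrow> (\<forall>x\<in>U. \<forall>\<^sub>F (x', y) in uniformity. x' = x \<longrightarrow> y \<in> U)"

lemma inner_rseq_superset:
  assumes "finite S" "{i. coord x i \<noteq> 0} \<subseteq> S"
  shows "inner x y = (\<Sum>i\<in>S. coord x i * coord y i)"
  unfolding inner_rseq_def using assms by (intro sum.mono_neutral_left) auto

instance
proof
  fix x y z :: rseq and r :: real
  show "dist x y = norm (x - y)" by (rule dist_rseq_def)
  show "sgn x = x /\<^sub>R norm x" by (rule sgn_rseq_def)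
  show "norm x = sqrt (inner x x)" by (rule norm_rseq_def)
  show "inner x y = inner y x"
    using inner_rseq_superset [of "{i. coord x i \<noteq> 0} \<union> {i. coord y i \<noteq> 0}" x y]
      inner_rseq_superset [of "{i. coord x i \<noteq> 0} \<union> {i. coord y i \<noteq> 0}" y x]
    by (simp add: mult.commute)
  let ?S = "{i. coord x i \<noteq> 0} \<union> {i. coord y i \<noteq> 0}"
  have "{i. coord (x + y) i \<noteq> 0} \<subseteq> ?S"
    by (auto simp: plus_rseq.rep_eq)
  then show "inner (x + y) z = inner x z + inner y z"
    using inner_rseq_superset [of ?S "x + y" z] inner_rseq_superset [of ?S x z]
      inner_rseq_superset [of ?S y z]
    by (simp add: plus_rseq.rep_eq algebra_simps sum.distrib)
  have "{i. coord (r *\<^sub>R x) i \<noteq> 0} \<subseteq> {i. coord x i \<noteq> 0}"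
    by (auto simp: scaleR_rseq.rep_eq)
  then show "inner (r *\<^sub>R x) y = r * inner x y"
    using inner_rseq_superset [of "{i. coord x i \<noteq> 0}" "r *\<^sub>R x" y]
    by (simp add: inner_rseq_def scaleR_rseq.rep_eq sum_distrib_left mult.assoc)
  show "0 \<le> inner x x"
    by (simp add: inner_rseq_def sum_nonneg)
  show "inner x x = 0 \<longleftrightarrow> x = 0"
  proof
    assume "inner x x = 0"
    then have "\<forall>i\<in>{i. coord x i \<noteq> 0}. coord x i * coord x i = 0"
      unfolding inner_rseq_def by (subst (asm) sum_nonneg_eq_0_iff) auto
    then have "coord x = (\<lambda>_. 0)" by auto
    then have "coord x = coord 0" by (simp only: zero_rseq.rep_eq)
    then show "x = 0" by (simp only: coord_inject)
  qed (simp add: inner_rseq_def zero_rseq.rep_eq)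
qed (simp_all add: uniformity_rseq_def open_rseq_def)

end

definition Rd :: "nat \<Rightarrow> rseq set"
  where "Rd d = {x. \<forall>i\<ge>d. coord x i = 0}"

lemma inner_Rd:
  assumes "x \<in> Rd d"
  shows "inner x y = (\<Sum>i<d. coord x i * coord y i)"
  using assms by (intro inner_rseq_superset) (auto simp: Rd_def not_le [symmetric])

lemma subspace_Rd: "subspace (Rd d)"
  by (auto simp: subspace_def Rd_def zero_rseq.rep_eq plus_rseq.rep_eq scaleR_rseq.rep_eq)


section \<open>Higher derivatives and higher-order smoothness\<close>

text \<open>
  \<open>hderiv E F [h\<^sub>1, \<dots>, h\<^sub>j] x\<close> is \<open>\<nabla>\<^sup>(\<^sup>j\<^sup>)F(x)[h\<^sub>1, \<dots>, h\<^sub>j]\<close>, the \<open>j\<close>-fold Frechet derivative of \<open>F\<close>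
  as a map on the subspace \<open>E\<close>. A Frechet derivative within \<open>E\<close> is determined only on directions
  in \<open>E\<close> (lemma \<open>frechet_derivative_within_subspace\<close>), and \<open>hderiv\<close> is only used for these.
\<close>

primrec hderiv ::
  "'a::real_normed_vector set \<Rightarrow> ('a \<Rightarrow> 'b::real_normed_vector) \<Rightarrow> 'a list \<Rightarrow> 'a \<Rightarrow> 'b"
where
  "hderiv E F [] x = F x"
| "hderiv E F (h # hs) x = frechet_derivative (hderiv E F hs) (at x within E) h"

lemma frechet_derivative_within_subspace:
  assumes E: "subspace E" "x \<in> E" "h \<in> E" and F': "(F has_derivative F') (at x within E)"
  shows "frechet_derivative F (at x within E) h = F' h"
proof -
  have *: "((\<lambda>t. F (x + t *\<^sub>R h)) has_derivative (\<lambda>t. G (t *\<^sub>R h))) (at 0)"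
    if G: "(F has_derivative G) (at x within E)" for G
  proof -
    have "((\<lambda>t::real. x + t *\<^sub>R h) has_derivative (\<lambda>t. t *\<^sub>R h)) (at 0)"
      by (auto intro!: derivative_eq_intros)
    moreover have "range (\<lambda>t::real. x + t *\<^sub>R h) \<subseteq> E"
      using E by (auto intro: subspace_add subspace_scale)
    ultimately show ?thesis
      using has_derivative_in_compose [of "\<lambda>t::real. x + t *\<^sub>R h" "\<lambda>t. t *\<^sub>R h" 0 UNIV F G]
        has_derivative_subset [OF G] by simp
  qed
  have "(F has_derivative frechet_derivative F (at x within E)) (at x within E)"
    using F' frechet_derivative_works differentiableI by blast
  from has_derivative_unique [OF * [OF this] * [OF F']] show ?thesis
    by (metis scaleR_one)
qed

text \<open>
  Differentiability and continuity of \<open>\<nabla>\<^sup>(\<^sup>j\<^sup>)F\<close> are stated for all its evaluations at fixed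
  directions; for finite-dimensional \<open>E\<close> this is the same as differentiability and continuity as a
  map into the space of multilinear maps.
\<close>

definition times_cont_differentiable ::
  "'a::real_normed_vector set \<Rightarrow> nat \<Rightarrow> ('a \<Rightarrow> 'b::real_normed_vector) \<Rightarrow> bool"
where
  "times_cont_differentiable E m F \<longleftrightarrow>
     (\<forall>hs. set hs \<subseteq> E \<longrightarrow> length hs < m \<longrightarrow>
        (\<forall>x\<in>E. hderiv E F hs differentiable (at x within E))) \<and>
     (\<forall>hs. set hs \<subseteq> E \<longrightarrow> length hs = m \<longrightarrow> continuous_on E (hderiv E F hs))"

text \<open>
  The operator norm of a \<open>j\<close>-linear map on \<open>E\<close>, given as a function of the list of its arguments.
  It is a supremum in \<open>ereal\<close>, so no boundedness proviso is needed.
\<close>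

definition multi_onorm ::
  "'a::real_normed_vector set \<Rightarrow> nat \<Rightarrow> ('a list \<Rightarrow> 'b::real_normed_vector) \<Rightarrow> ereal"
where
  "multi_onorm E j A = (SUP hs\<in>{hs. length hs = j \<and> set hs \<subseteq> E \<inter> cball 0 1}. ereal (norm (A hs)))"

definition order_smooth ::
  "'a::real_normed_vector set \<Rightarrow> nat \<Rightarrow> real \<Rightarrow> ('a \<Rightarrow> 'b::real_normed_vector) \<Rightarrow> bool"
where
  "order_smooth E m L F \<longleftrightarrow>
     times_cont_differentiable E m F \<and>
     (\<forall>x\<in>E. \<forall>x'\<in>E.
        multi_onorm E m (\<lambda>hs. hderiv E F hs x - hderiv E F hs x') \<le> ereal (L * norm (x - x')))"


section \<open>Variational inequalities and the Perseus method\<close>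

definition vi_solution :: "'a::real_inner set \<Rightarrow> ('a \<Rightarrow> 'a) \<Rightarrow> 'a \<Rightarrow> bool"
  where "vi_solution X F y \<longleftrightarrow> y \<in> X \<and> (\<forall>x\<in>X. inner (F y) (x - y) \<ge> 0)"

text \<open>A real supremum: it is only used for nonempty bounded \<open>X\<close>, where it is a genuine one.\<close>

definition res :: "'a::real_inner set \<Rightarrow> ('a \<Rightarrow> 'a) \<Rightarrow> 'a \<Rightarrow> real"
  where "res X F y = (SUP x\<in>X. inner (F y) (y - x))"

definition reg_taylor ::
  "'a::real_inner set \<Rightarrow> ('a \<Rightarrow> 'a) \<Rightarrow> nat \<Rightarrow> real \<Rightarrow> 'a \<Rightarrow> 'a \<Rightarrow> 'a"
where
  "reg_taylor E F p L v x =
     (\<Sum>j<p. (1 / fact j) *\<^sub>R hderiv E F (replicate j (x - v)) v) +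
     (5 * L / fact (p - 1) * norm (x - v) ^ (p - 1)) *\<^sub>R (x - v)"

text \<open>For given \<open>s\<^sub>k = s\<close>, the points \<open>v\<close> and \<open>y\<close> are admissible choices of \<open>v\<^sub>k\<^sub>+\<^sub>1\<close> and \<open>x\<^sub>k\<^sub>+\<^sub>1\<close>.\<close>

definition perseus_step ::
  "'a::real_inner set \<Rightarrow> 'a set \<Rightarrow> ('a \<Rightarrow> 'a) \<Rightarrow> nat \<Rightarrow> real \<Rightarrow> 'a \<Rightarrow> 'a \<Rightarrow> 'a \<Rightarrow> 'a \<Rightarrow> bool"
where
  "perseus_step E X F p L x0 s v y \<longleftrightarrow>
     is_arg_max (\<lambda>w. inner s (w - x0) - (norm (w - x0))\<^sup>2 / 2) (\<lambda>w. w \<in> X) v \<and>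
     y \<in> X \<and> res X (reg_taylor E F p L v) y \<le> L / fact p * norm (y - v) ^ (p + 1)"

text \<open>The sequences are those of the first \<open>K\<close> iterations, none of which has stopped the method.\<close>

definition perseus_iterates ::
  "'a::real_inner set \<Rightarrow> 'a set \<Rightarrow> ('a \<Rightarrow> 'a) \<Rightarrow> nat \<Rightarrow> real \<Rightarrow> 'a \<Rightarrow> nat \<Rightarrow>
     (nat \<Rightarrow> 'a) \<Rightarrow> (nat \<Rightarrow> 'a) \<Rightarrow> (nat \<Rightarrow> 'a) \<Rightarrow> (nat \<Rightarrow> real) \<Rightarrow> bool"
where
  "perseus_iterates E X F p L x0 K x v s lam \<longleftrightarrow>
     x 0 = x0 \<and> s 0 = 0 \<and>
     (\<forall>k<K.
        \<not> vi_solution X F (x k) \<and>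
        perseus_step E X F p L x0 (s k) (v (k + 1)) (x (k + 1)) \<and>
        \<not> (2 \<le> p \<and> x (k + 1) = v (k + 1)) \<and>
        0 < lam (k + 1) \<and>
        1 / (20 * real p - 8) \<le> lam (k + 1) * L * norm (x (k + 1) - v (k + 1)) ^ (p - 1) / fact p \<and>
        lam (k + 1) * L * norm (x (k + 1) - v (k + 1)) ^ (p - 1) / fact p \<le> 1 / (10 * real p + 2) \<and>
        s (k + 1) = s k - lam (k + 1) *\<^sub>R F (x (k + 1)))"

text \<open>
  \<open>perseus E X F p L x0 T y n\<close>: some run of \<open>Perseus(p, x0, L, T, 2)\<close> returns \<open>y\<close> after \<open>n\<close> calls of the
  subproblem solver.
\<close>

inductive perseus ::
  "'a::real_inner set \<Rightarrow> 'a set \<Rightarrow> ('a \<Rightarrow> 'a) \<Rightarrow> nat \<Rightarrow> real \<Rightarrow> 'a \<Rightarrow> nat \<Rightarrow> 'a \<Rightarrow> nat \<Rightarrow> bool"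
  for E X F p L x0 T
where
  stop_solution:
    "perseus_iterates E X F p L x0 k x v s lam \<Longrightarrow> k < T \<Longrightarrow>
     vi_solution X F (x k) \<Longrightarrow>
     perseus E X F p L x0 T (x k) k"
| stop_fixed_point:
    "perseus_iterates E X F p L x0 k x v s lam \<Longrightarrow> k < T \<Longrightarrow>
     \<not> vi_solution X F (x k) \<Longrightarrow> perseus_step E X F p L x0 (s k) w y \<Longrightarrow>
     2 \<le> p \<Longrightarrow> y = w \<Longrightarrow>
     perseus E X F p L x0 T y (k + 1)"
| finish:
    "perseus_iterates E X F p L x0 T x v s lam \<Longrightarrow>
     is_arg_min (\<lambda>k. norm (x k - v k)) (\<lambda>k. k \<in> {1..T}) kT \<Longrightarrow>
     perseus E X F p L x0 T (x kT) T"

end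

theory Submission
  imports Defs
begin

text \<open>
  Write \<open>r\<^sub>k = \<parallel>x\<^sub>k - v\<^sub>k\<parallel>\<close>. The rate comes from two facts about one run of the method.

  The residual of an iterate is controlled by \<open>r\<^sub>k\<close>: the regularised Taylor model differs from \<open>F\<close>
  by \<open>O(L r\<^sub>k\<^sup>p)\<close> at \<open>x\<^sub>k\<close>, and \<open>x\<^sub>k\<close> nearly solves the variational inequality of the model, so
  \<open>\<langle>F(x\<^sub>k), x\<^sub>k - x\<rangle> \<le> O(L D r\<^sub>k\<^sup>p)\<close> on \<open>X\<close> (lemma \<open>residual_le_step_length\<close>).

  The squares of the \<open>r\<^sub>k\<close> are summable: \<open>\<Sum> r\<^sub>k\<^sup>2 \<le> 4 D\<^sup>2\<close> (lemma \<open>sum_step_lengths_le\<close>). This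
  is a dual-averaging argument. The potential is
  \<open>max\<^sub>w \<langle>s\<^sub>k, w - x\<^sub>0\<rangle> - \<parallel>w - x\<^sub>0\<parallel>\<^sup>2/2 + \<Sum>\<^sub>i \<lambda>\<^sub>i \<langle>F(x\<^sub>i), x\<^sub>i - x\<^sub>0\<rangle>\<close>. It starts at \<open>0\<close>; since the maximised
  function is strongly concave and \<open>\<lambda>\<^sub>k\<close> is tuned to \<open>r\<^sub>k\<close>, iteration \<open>k\<close> lowers it by at least
  \<open>r\<^sub>k\<^sup>2/8\<close> (lemma \<open>step_decrease\<close>); and evaluating the maximum at the Minty point shows that it
  never drops below \<open>-D\<^sup>2/2\<close>.

  Hence the smallest \<open>r\<^sub>k\<close> is at most \<open>2 D / sqrt T\<close>, the residual at that iterate is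
  \<open>O(L D\<^bsup>p+1\<^esup> T\<^bsup>-p/2\<^esup>)\<close>, and it remains to solve for \<open>T\<close>. The bounds in the step-size rule are
  matched to the Taylor remainder with its sharp constant \<open>L/p!\<close>, so that is the form proved here.
\<close>

section \<open>Taylor's theorem with Lipschitz top derivative\<close>

text \<open>
  Comparing \<open>G\<^sub>0\<close> minus its Taylor polynomial with \<open>M t\<^bsup>m+1\<^esup>/(m+1)!\<close> through derivatives, one
  order at a time, gives the sharp constant; a Lagrange remainder of order \<open>m\<close> would only give
  \<open>M t\<^bsup>m+1\<^esup>/m!\<close>.
\<close>

lemma taylor_remainder_Lipschitz:
  fixes G :: "nat \<Rightarrow> real \<Rightarrow> 'b::real_normed_vector"
  assumes "\<And>j t. j < m \<Longrightarrow> (G j has_vector_derivative G (Suc j) t) (at t)"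
    and "\<And>t. 0 \<le> t \<Longrightarrow> norm (G m t - G m 0) \<le> M * t"
    and "0 \<le> t"
  shows "norm (G 0 t - (\<Sum>j\<le>m. (t ^ j / fact j) *\<^sub>R G j 0)) \<le> M * t ^ Suc m / fact (Suc m)"
  using assms
proof (induction m arbitrary: G t)
  case 0
  then show ?case by simp
next
  case (Suc m)
  define R where "R t = G 0 t - (\<Sum>j\<le>Suc m. (t ^ j / fact j) *\<^sub>R G j 0)" for t
  define R' where "R' t = G 1 t - (\<Sum>j\<le>m. (t ^ j / fact j) *\<^sub>R G (Suc j) 0)" for t
  define B where "B t = M * t ^ Suc (Suc m) / fact (Suc (Suc m))" for t :: real
  define B' where "B' t = M * t ^ Suc m / fact (Suc m)" for t :: real
  have bound: "norm (R' t) \<le> B' t" if "0 \<le> t" for t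
    using Suc.IH [of "\<lambda>j. G (Suc j)" t] Suc.prems that by (simp add: R'_def B'_def)
  have monomial: "((\<lambda>t. t ^ Suc j / fact (Suc j)) has_field_derivative t ^ j / fact j) (at t)"
    for j and t :: real
    using DERIV_cdivide [OF DERIV_pow [of "Suc j" t], of "fact (Suc j)"]
    by (simp del: of_nat_Suc)
  have R_deriv: "(R has_vector_derivative R' t) (at t)" for t
  proof -
    have R: "R = (\<lambda>t. G 0 t - (G 0 0 + (\<Sum>j\<le>m. (t ^ Suc j / fact (Suc j)) *\<^sub>R G (Suc j) 0)))"
      unfolding R_def by (subst sum.atMost_Suc_shift) simp
    have "((\<lambda>t. (t ^ Suc j / fact (Suc j)) *\<^sub>R G (Suc j) 0)
        has_vector_derivative (t ^ j / fact j) *\<^sub>R G (Suc j) 0) (at t)" for j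
      using has_vector_derivative_scaleR [OF monomial has_vector_derivative_const] by simp
    then have sum: "((\<lambda>t. \<Sum>j\<le>m. (t ^ Suc j / fact (Suc j)) *\<^sub>R G (Suc j) 0)
        has_vector_derivative (\<Sum>j\<le>m. (t ^ j / fact j) *\<^sub>R G (Suc j) 0)) (at t)"
      by (intro has_vector_derivative_sum)
    have "(G 0 has_vector_derivative G 1 t) (at t)"
      using Suc.prems(1) [of 0 t] by simp
    with sum have "((\<lambda>t. G 0 t - (G 0 0 + (\<Sum>j\<le>m. (t ^ Suc j / fact (Suc j)) *\<^sub>R G (Suc j) 0)))
        has_vector_derivative G 1 t - (0 + (\<Sum>j\<le>m. (t ^ j / fact j) *\<^sub>R G (Suc j) 0))) (at t)"
      by (intro has_vector_derivative_diff has_vector_derivative_add has_vector_derivative_const)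
    then show ?thesis
      by (simp only: R R'_def add_0)
  qed
  have B_deriv: "(B has_vector_derivative B' t) (at t)" for t
    using DERIV_cmult [OF monomial, of M "Suc m" t]
    by (simp add: B_def [abs_def] B'_def has_real_derivative_iff_has_vector_derivative)
  have R0: "R 0 = 0" and B0: "B 0 = 0"
    unfolding R_def B_def by (subst sum.atMost_Suc_shift, simp) simp
  show ?case
  proof (cases "t = 0")
    case True
    then show ?thesis using R0 B0 by (simp add: R_def B_def)
  next
    case False
    have "norm (R t - R 0) \<le> B t - B 0"
    proof (rule differentiable_bound_general)
      show "0 < t" using False Suc.prems by simp
      show "continuous_on {0..t} R" "continuous_on {0..t} B"
        using R_deriv B_deriv
        by (meson continuous_at_imp_continuous_on has_vector_derivative_continuous)+
    qed (use R_deriv B_deriv bound in auto)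
    then show ?thesis using R0 B0 by (simp add: R_def B_def)
  qed
qed

section \<open>Higher derivatives along a line\<close>

lemma hderiv_scale:
  assumes E: "subspace E" and F: "times_cont_differentiable E m F"
    and "length hs \<le> m" "set hs \<subseteq> E" "x \<in> E"
  shows "hderiv E F (map ((*\<^sub>R) c) hs) x = c ^ length hs *\<^sub>R hderiv E F hs x"
  using assms(3-5)
proof (induction hs arbitrary: x)
  case Nil
  then show ?case by simp
next
  case (Cons h hs)
  let ?f = "hderiv E F hs" and ?f' = "frechet_derivative (hderiv E F hs) (at x within E)"
  have "?f differentiable (at x within E)"
    using F Cons.prems by (simp add: times_cont_differentiable_def)
  then have f': "(?f has_derivative ?f') (at x within E)"
    by (simp add: frechet_derivative_works)
  then have "((\<lambda>y. c ^ length hs *\<^sub>R ?f y) has_derivative (\<lambda>h. c ^ length hs *\<^sub>R ?f' h)) (at x within E)"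
    by (rule has_derivative_scaleR_right)
  then have "(hderiv E F (map ((*\<^sub>R) c) hs) has_derivative (\<lambda>h. c ^ length hs *\<^sub>R ?f' h)) (at x within E)"
    by (rule has_derivative_transform [rotated 2]) (use Cons in auto)
  then have "frechet_derivative (hderiv E F (map ((*\<^sub>R) c) hs)) (at x within E) (c *\<^sub>R h)
      = c ^ length hs *\<^sub>R ?f' (c *\<^sub>R h)"
    using Cons.prems E by (intro frechet_derivative_within_subspace) (auto simp: subspace_scale)
  moreover have "?f' (c *\<^sub>R h) = c *\<^sub>R ?f' h"
    using f' by (simp add: has_derivative_linear linear_cmul)
  ultimately show ?case by (simp add: mult.commute)
qed

lemma hderiv_has_vector_derivative_on_line:
  assumes E: "subspace E" "v \<in> E" "h \<in> E" and F: "times_cont_differentiable E m F"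
    and hs: "length hs < m" "set hs \<subseteq> E"
  shows "((\<lambda>t. hderiv E F hs (v + t *\<^sub>R h)) has_vector_derivative hderiv E F (h # hs) (v + t *\<^sub>R h)) (at t)"
proof -
  let ?x = "v + t *\<^sub>R h"
  let ?f' = "frechet_derivative (hderiv E F hs) (at ?x within E)"
  have line: "v + t *\<^sub>R h \<in> E" for t
    using E by (simp add: subspace_add subspace_scale)
  have f': "(hderiv E F hs has_derivative ?f') (at ?x within E)"
    using F hs line by (simp add: times_cont_differentiable_def flip: frechet_derivative_works)
  have "((\<lambda>t. v + t *\<^sub>R h) has_derivative (\<lambda>t. t *\<^sub>R h)) (at t)"
    by (auto intro!: derivative_eq_intros)
  moreover have "(hderiv E F hs has_derivative ?f') (at ?x within range (\<lambda>t. v + t *\<^sub>R h))"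
    using f' by (rule has_derivative_subset) (use line in auto)
  ultimately have "((\<lambda>t. hderiv E F hs (v + t *\<^sub>R h)) has_derivative (\<lambda>t. ?f' (t *\<^sub>R h))) (at t)"
    by (rule has_derivative_in_compose)
  then show ?thesis
    using f' by (simp add: has_vector_derivative_def has_derivative_linear linear_cmul)
qed

text \<open>
  The operator norm only sees directions in the unit ball, so \<open>h\<close> is normalised first; with the
  convention \<open>sgn 0 = 0\<close> this also covers \<open>h = 0\<close>.
\<close>

lemma order_smooth_diagonal_Lipschitz:
  fixes F :: "'a::real_inner \<Rightarrow> 'b::real_normed_vector"
  assumes E: "subspace E" and F: "order_smooth E m L F" and xs: "x \<in> E" "x' \<in> E" "h \<in> E"
  shows "norm (hderiv E F (replicate m h) x - hderiv E F (replicate m h) x')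
    \<le> L * norm (x - x') * norm h ^ m"
proof -
  let ?hs = "replicate m (sgn h)"
  have h: "sgn h \<in> E" "norm (sgn h) \<le> 1" "norm h *\<^sub>R sgn h = h"
    using E xs by (cases "h = 0"; simp add: sgn_div_norm subspace_scale)+
  have diff: "times_cont_differentiable E m F"
    using F by (simp add: order_smooth_def)
  have set: "set ?hs \<subseteq> E" using h by auto
  have scale: "hderiv E F (replicate m h) y = norm h ^ m *\<^sub>R hderiv E F ?hs y" if "y \<in> E" for y
    using hderiv_scale [OF E diff _ set that, of "norm h"] h by simp
  have "ereal (norm (hderiv E F ?hs x - hderiv E F ?hs x'))
      \<le> multi_onorm E m (\<lambda>hs. hderiv E F hs x - hderiv E F hs x')"
    unfolding multi_onorm_def using h by (intro SUP_upper) auto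
  also have "\<dots> \<le> ereal (L * norm (x - x'))"
    using F xs by (simp add: order_smooth_def)
  finally have "norm (hderiv E F ?hs x - hderiv E F ?hs x') \<le> L * norm (x - x')"
    by simp
  then have "norm h ^ m * norm (hderiv E F ?hs x - hderiv E F ?hs x') \<le> norm h ^ m * (L * norm (x - x'))"
    by (rule mult_left_mono) simp
  moreover have "hderiv E F (replicate m h) x - hderiv E F (replicate m h) x'
      = norm h ^ m *\<^sub>R (hderiv E F ?hs x - hderiv E F ?hs x')"
    using xs by (simp add: scale scaleR_diff_right)
  ultimately show ?thesis by (simp add: mult.commute)
qed

lemma taylor_remainder_order_smooth:
  fixes F :: "'a::real_inner \<Rightarrow> 'b::real_normed_vector"
  assumes E: "subspace E" "x \<in> E" "v \<in> E" and F: "order_smooth E m L F"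
  shows "norm (F x - (\<Sum>j\<le>m. (1 / fact j) *\<^sub>R hderiv E F (replicate j (x - v)) v))
    \<le> L / fact (Suc m) * norm (x - v) ^ Suc m"
proof -
  define h where "h = x - v"
  define G where "G j t = hderiv E F (replicate j h) (v + t *\<^sub>R h)" for j and t :: real
  have h: "h \<in> E" using E by (simp add: h_def subspace_diff)
  have diff: "times_cont_differentiable E m F"
    using F by (simp add: order_smooth_def)
  have "norm (G 0 1 - (\<Sum>j\<le>m. (1 ^ j / fact j) *\<^sub>R G j 0))
      \<le> L * norm h ^ Suc m * 1 ^ Suc m / fact (Suc m)"
  proof (rule taylor_remainder_Lipschitz)
    show "(G j has_vector_derivative G (Suc j) t) (at t)" if "j < m" for j t
    proof -
      have "set (replicate j h) \<subseteq> E" using h by auto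
      then show ?thesis
        using hderiv_has_vector_derivative_on_line [OF E(1,3) h diff, of "replicate j h" t] that
        by (simp add: G_def [abs_def])
    qed
    show "norm (G m t - G m 0) \<le> L * norm h ^ Suc m * t" if "0 \<le> t" for t
      using order_smooth_diagonal_Lipschitz [OF E(1) F, of "v + t *\<^sub>R h" v h] that E h
      by (simp add: G_def subspace_add subspace_scale mult_ac)
  qed simp
  then show ?thesis by (simp add: G_def h_def mult_ac)
qed

section \<open>One subproblem\<close>

lemma inner_le_res:
  fixes X :: "'a::real_inner set"
  assumes "bounded X" "x \<in> X"
  shows "inner (F y) (y - x) \<le> res X F y"
  unfolding res_def
proof (rule cSUP_upper [OF assms(2)])
  obtain b where b: "\<And>x. x \<in> X \<Longrightarrow> norm x \<le> b"
    using assms(1) by (auto simp: bounded_iff)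
  show "bdd_above ((\<lambda>x. inner (F y) (y - x)) ` X)"
  proof (rule bdd_aboveI2)
    fix x assume "x \<in> X"
    have "inner (F y) (y - x) \<le> norm (F y) * norm (y - x)" by (rule norm_cauchy_schwarz)
    also have "\<dots> \<le> norm (F y) * (norm y + b)"
      by (intro mult_left_mono order_trans [OF norm_triangle_ineq4])
        (use b [OF \<open>x \<in> X\<close>] in auto)
    finally show "inner (F y) (y - x) \<le> norm (F y) * (norm y + b)" .
  qed
qed

lemma res_le_iff:
  fixes X :: "'a::real_inner set"
  assumes "bounded X" "X \<noteq> {}"
  shows "res X F y \<le> b \<longleftrightarrow> (\<forall>x\<in>X. inner (F y) (y - x) \<le> b)"
proof
  assume "res X F y \<le> b"
  then show "\<forall>x\<in>X. inner (F y) (y - x) \<le> b"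
    using inner_le_res [OF assms(1)] order_trans by blast
next
  assume "\<forall>x\<in>X. inner (F y) (y - x) \<le> b"
  then show "res X F y \<le> b"
    unfolding res_def by (intro cSUP_least assms(2)) auto
qed

lemma vi_solution_iff_res:
  fixes X :: "'a::real_inner set"
  assumes "bounded X" "y \<in> X"
  shows "vi_solution X F y \<longleftrightarrow> res X F y \<le> 0"
proof -
  have "inner (F y) (x - y) \<ge> 0 \<longleftrightarrow> inner (F y) (y - x) \<le> 0" for x
    by (simp add: inner_diff_right)
  moreover have "X \<noteq> {}" using assms(2) by auto
  ultimately show ?thesis
    using assms by (simp add: vi_solution_def res_le_iff)
qed

text \<open>
  Transfers the approximate solution of the model problem to \<open>F\<close>: the three terms are the Taylor
  remainder, the accuracy of the subproblem solver and the regulariser, which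
  \<open>fact p = p * fact (p - 1)\<close> brings over a common factor.
\<close>

lemma inner_le_of_subproblem:
  fixes X :: "'a::real_inner set"
  assumes E: "subspace E" "X \<subseteq> E" and X: "bounded X" and p: "p \<ge> 1"
    and F: "order_smooth E (p - 1) L F" and v: "v \<in> X" and y: "y \<in> X"
    and sub: "res X (reg_taylor E F p L v) y \<le> L / fact p * norm (y - v) ^ (p + 1)"
    and w: "w \<in> X"
  shows "inner (F y) (y - w) \<le> L / fact p * norm (y - v) ^ (p - 1) *
    (norm (y - v) * norm (y - w) + (norm (y - v))\<^sup>2 - 5 * real p * inner (y - v) (y - w))"
proof -
  obtain m where m: "p = Suc m" using p by (cases p) auto
  define r where "r = norm (y - v)"
  define A where "A = (\<Sum>j\<le>m. (1 / fact j) *\<^sub>R hderiv E F (replicate j (y - v)) v)"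
  have model: "reg_taylor E F p L v y = A + (5 * L / fact m * r ^ m) *\<^sub>R (y - v)"
    by (simp add: reg_taylor_def m A_def r_def lessThan_Suc_atMost)
  have split: "inner (F y) (y - w) = inner (F y - A) (y - w) + inner (reg_taylor E F p L v y) (y - w)
      - 5 * L / fact m * r ^ m * inner (y - v) (y - w)"
    unfolding model by (simp add: inner_diff_left inner_add_left)
  have "inner (F y - A) (y - w) \<le> norm (F y - A) * norm (y - w)"
    by (rule norm_cauchy_schwarz)
  also have "\<dots> \<le> L / fact p * r ^ p * norm (y - w)"
    using taylor_remainder_order_smooth [OF E(1), of y v m L F] E v y F
    by (intro mult_right_mono) (auto simp: A_def r_def m)
  finally have "inner (F y - A) (y - w) \<le> L / fact p * r ^ p * norm (y - w)" .
  moreover have "inner (reg_taylor E F p L v y) (y - w) \<le> L / fact p * r ^ (p + 1)"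
    using inner_le_res [OF X w, of "reg_taylor E F p L v" y] sub by (simp add: r_def)
  moreover have "5 * L / fact m * r ^ m = 5 * real p * (L / fact p * r ^ m)"
    by (simp add: m field_simps del: of_nat_Suc)
  ultimately have "inner (F y) (y - w) \<le> L / fact p * r ^ p * norm (y - w) + L / fact p * r ^ (p + 1)
      - 5 * real p * (L / fact p * r ^ m) * inner (y - v) (y - w)"
    unfolding split by simp
  moreover have "c * r ^ p * n + c * r ^ (p + 1) - 5 * real p * (c * r ^ m) * I
      = c * r ^ (p - 1) * (r * n + r\<^sup>2 - 5 * real p * I)" for c n I
    by (simp add: m algebra_simps power2_eq_square del: of_nat_Suc)
  ultimately show ?thesis by (simp only: r_def)
qed

text \<open>
  Of the two distances in each term, one factor \<open>\<parallel>y - v\<parallel>\<close> is kept to reach the power \<open>p\<close>, and the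
  other distance is bounded by the diameter.
\<close>

lemma residual_le_step_length:
  fixes X :: "'a::real_inner set"
  assumes E: "subspace E" "X \<subseteq> E" and X: "bounded X" and p: "p \<ge> 1" and L: "L > 0"
    and F: "order_smooth E (p - 1) L F" and v: "v \<in> X" and y: "y \<in> X"
    and sub: "res X (reg_taylor E F p L v) y \<le> L / fact p * norm (y - v) ^ (p + 1)"
  shows "res X F y \<le> (5 * real p + 2) / fact p * L * diameter X * norm (y - v) ^ p"
proof -
  define r where "r = norm (y - v)"
  have D: "norm (a - b) \<le> diameter X" if "a \<in> X" "b \<in> X" for a b
    using diameter_bounded_bound [OF X that] by (simp add: dist_norm)
  have "inner (F y) (y - x) \<le> (5 * real p + 2) / fact p * L * diameter X * r ^ p" if x: "x \<in> X" for x
  proof -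
    have r: "0 \<le> r" "r \<le> diameter X" using D [OF y v] by (simp_all add: r_def)
    have "- inner (y - v) (y - x) \<le> r * norm (y - x)"
      using norm_cauchy_schwarz [of "v - y" "y - x"]
      by (simp add: r_def norm_minus_commute inner_diff_left)
    then have "5 * real p * - inner (y - v) (y - x) \<le> 5 * real p * (r * norm (y - x))"
      by (rule mult_left_mono) simp
    then have "- (5 * real p * inner (y - v) (y - x)) \<le> 5 * real p * (r * norm (y - x))"
      by (simp only: mult_minus_right)
    moreover have nD: "r * norm (y - x) \<le> r * diameter X" "r\<^sup>2 \<le> r * diameter X"
      using D [OF y x] r by (auto intro!: mult_left_mono simp: power2_eq_square)
    moreover have "5 * real p * (r * norm (y - x)) \<le> 5 * real p * (r * diameter X)"
      by (rule mult_left_mono [OF nD(1)]) simp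
    moreover have "(5 * real p + 2) * (r * diameter X) = 5 * real p * (r * diameter X) + 2 * (r * diameter X)"
      by (rule distrib_right)
    ultimately have "r * norm (y - x) + r\<^sup>2 - 5 * real p * inner (y - v) (y - x)
        \<le> (5 * real p + 2) * (r * diameter X)"
      by linarith
    then have "L / fact p * r ^ (p - 1) * (r * norm (y - x) + r\<^sup>2 - 5 * real p * inner (y - v) (y - x))
        \<le> L / fact p * r ^ (p - 1) * ((5 * real p + 2) * (r * diameter X))"
      using L r by (intro mult_left_mono) auto
    with inner_le_of_subproblem [OF E X p F v y sub x, folded r_def]
    have "inner (F y) (y - x) \<le> L / fact p * r ^ (p - 1) * ((5 * real p + 2) * (r * diameter X))"
      by (rule order_trans)
    also have "\<dots> = (5 * real p + 2) / fact p * L * diameter X * (r * r ^ (p - 1))"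
      by (simp only: times_divide_eq_left times_divide_eq_right ac_simps)
    also have "r * r ^ (p - 1) = r ^ p"
      using p by (simp add: power_eq_if)
    finally show ?thesis .
  qed
  moreover have "X \<noteq> {}" using y by auto
  ultimately show ?thesis
    unfolding r_def using res_le_iff [OF X] by blast
qed

text \<open>
  With \<open>\<theta> = \<lambda> L r\<^bsup>p-1\<^esup>/p!\<close> and \<open>q = \<parallel>w - v\<parallel>\<close>, the upper bound on \<open>\<theta>\<close> makes the cross term at most
  \<open>r q / 2\<close>. The regulariser outweighs the Taylor error and the solver error by \<open>(5p - 2) \<theta> r\<^sup>2\<close>,
  which is at least \<open>r\<^sup>2/4\<close> by the lower bound on \<open>\<theta>\<close>, and
  \<open>- r\<^sup>2/4 + r q/2 - q\<^sup>2/2 \<le> - r\<^sup>2/8\<close> by completing the square.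
\<close>

lemma step_decrease:
  fixes X :: "'a::real_inner set"
  assumes E: "subspace E" "X \<subseteq> E" and X: "bounded X" and p: "p \<ge> 1"
    and F: "order_smooth E (p - 1) L F" and v: "v \<in> X" and y: "y \<in> X"
    and sub: "res X (reg_taylor E F p L v) y \<le> L / fact p * norm (y - v) ^ (p + 1)"
    and w: "w \<in> X" and lam: "0 < lam"
    and lower: "1 / (20 * real p - 8) \<le> lam * L * norm (y - v) ^ (p - 1) / fact p"
    and upper: "lam * L * norm (y - v) ^ (p - 1) / fact p \<le> 1 / (10 * real p + 2)"
  shows "lam * inner (F y) (y - w) - (norm (w - v))\<^sup>2 / 2 \<le> - (norm (y - v))\<^sup>2 / 8"
proof -
  define r where "r = norm (y - v)"
  define q where "q = norm (w - v)"
  define \<theta> where "\<theta> = lam * L * r ^ (p - 1) / fact p"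
  define P where "P = real p"
  have P: "P \<ge> 1" using p by (simp add: P_def)
  have nonneg: "0 \<le> r" "0 \<le> q" by (simp_all add: r_def q_def)
  have \<theta>_lower: "1 / (20 * P - 8) \<le> \<theta>" and \<theta>_upper: "\<theta> \<le> 1 / (10 * P + 2)"
    using lower upper by (simp_all add: \<theta>_def r_def P_def)
  have "0 < \<theta>"
    by (rule less_le_trans [OF _ \<theta>_lower]) (use P in simp)
  have "lam * inner (F y) (y - w)
      \<le> lam * (L / fact p * r ^ (p - 1) * (r * norm (y - w) + r\<^sup>2 - 5 * P * inner (y - v) (y - w)))"
    using mult_left_mono [OF inner_le_of_subproblem [OF E X p F v y sub w], of lam] lam
    by (simp add: r_def P_def)
  also have "\<dots> = \<theta> * (r * norm (y - w) + r\<^sup>2 - 5 * P * inner (y - v) (y - w))"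
    by (simp add: \<theta>_def)
  also have "\<dots> \<le> \<theta> * ((5 * P + 1) * (r * q) - (5 * P - 2) * r\<^sup>2)"
  proof (rule mult_left_mono)
    have "norm (y - w) \<le> r + q"
      using norm_triangle_ineq4 [of "y - v" "w - v"] by (simp add: r_def q_def)
    then have "r * norm (y - w) \<le> r * (r + q)" using nonneg by (intro mult_left_mono)
    moreover have "r\<^sup>2 - r * q \<le> inner (y - v) (y - w)"
    proof -
      have "inner (y - v) (y - w) = r\<^sup>2 - inner (y - v) (w - v)"
        by (simp add: r_def power2_norm_eq_inner inner_diff_left inner_diff_right)
      then show ?thesis
        using norm_cauchy_schwarz [of "y - v" "w - v"] by (simp add: r_def q_def)
    qed
    then have "5 * P * (r\<^sup>2 - r * q) \<le> 5 * P * inner (y - v) (y - w)"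
      using P by (intro mult_left_mono) auto
    moreover have "5 * P * (r\<^sup>2 - r * q) = r * (r + q) + r\<^sup>2 - ((5 * P + 1) * (r * q) - (5 * P - 2) * r\<^sup>2)"
      by (simp add: algebra_simps power2_eq_square)
    ultimately show "r * norm (y - w) + r\<^sup>2 - 5 * P * inner (y - v) (y - w)
        \<le> (5 * P + 1) * (r * q) - (5 * P - 2) * r\<^sup>2"
      by linarith
  qed (use \<open>0 < \<theta>\<close> in simp)
  also have "\<dots> = (\<theta> * (5 * P + 1)) * (r * q) - (\<theta> * (5 * P - 2)) * r\<^sup>2"
    by (simp add: algebra_simps)
  also have "\<dots> \<le> 1 / 2 * (r * q) - 1 / 4 * r\<^sup>2"
  proof (intro diff_mono mult_right_mono)
    show "\<theta> * (5 * P + 1) \<le> 1 / 2" using \<theta>_upper P by (simp add: field_simps)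
    show "1 / 4 \<le> \<theta> * (5 * P - 2)" using \<theta>_lower P by (simp add: field_simps)
  qed (use nonneg in auto)
  also have "\<dots> = q\<^sup>2 / 2 - r\<^sup>2 / 8 - (q - r / 2)\<^sup>2 / 2"
    by (simp add: power2_eq_square field_simps)
  finally show ?thesis
    using zero_le_power2 [of "q - r / 2"] unfolding r_def q_def by linarith
qed

section \<open>The potential argument\<close>

text \<open>
  The quadratic growth away from the maximiser that strong concavity gives: it follows from
  the first-order condition \<open>\<langle>s - (v - x0), w - v\<rangle> \<le> 0\<close>, obtained by moving from \<open>v\<close> towards \<open>w\<close>
  by a small \<open>t\<close>.
\<close>

lemma prox_argmax_quadratic_growth:
  fixes X :: "'a::real_inner set"
  assumes X: "convex X"
    and v: "is_arg_max (\<lambda>w. inner s (w - x0) - (norm (w - x0))\<^sup>2 / 2) (\<lambda>w. w \<in> X) v"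
    and w: "w \<in> X"
  shows "inner s (w - x0) - (norm (w - x0))\<^sup>2 / 2
    \<le> inner s (v - x0) - (norm (v - x0))\<^sup>2 / 2 - (norm (w - v))\<^sup>2 / 2"
proof -
  define f where "f w = inner s (w - x0) - (norm (w - x0))\<^sup>2 / 2" for w
  define g where "g = inner (s - (v - x0)) (w - v)"
  define N where "N = (norm (w - v))\<^sup>2"
  have vX: "v \<in> X" and max: "\<And>u. u \<in> X \<Longrightarrow> f u \<le> f v"
    using v by (auto simp: is_arg_max_def f_def not_less)
  have expand: "f (v + t *\<^sub>R (w - v)) = f v + t * g - t\<^sup>2 * N / 2" for t
    unfolding f_def g_def N_def power2_norm_eq_inner
    by (simp add: inner_diff_left inner_diff_right inner_add_left inner_add_right
        inner_commute power2_eq_square field_simps)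
  have "g \<le> 0"
  proof (rule ccontr)
    assume "\<not> g \<le> 0"
    then have g: "0 < g" by simp
    have N: "0 \<le> N" by (simp add: N_def)
    \<comment> \<open>so short a step that the quadratic loss \<open>t N / 2\<close> per unit of \<open>t\<close> stays below the gain \<open>g\<close>\<close>
    define t where "t = min 1 (g / (N + 1))"
    have t: "0 < t" "t \<le> 1" "t * (N + 1) \<le> g"
      using g N by (simp_all add: t_def flip: pos_le_divide_eq)
    have "v + t *\<^sub>R (w - v) = (1 - t) *\<^sub>R v + t *\<^sub>R w" by (simp add: algebra_simps)
    then have "v + t *\<^sub>R (w - v) \<in> X"
      using convexD_alt [OF X vX w, of t] t by simp
    then have "t * g \<le> t * (t * N / 2)"
      using max expand [of t] by (fastforce simp: power2_eq_square)
    then have "g \<le> t * N / 2" using t by simp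
    moreover have "t * N / 2 \<le> t * N" using t N by simp
    ultimately show False using t by (simp add: algebra_simps)
  qed
  then show ?thesis
    using expand [of 1] by (simp add: f_def N_def)
qed

text \<open>
  The potential is stated as a bound for every competitor \<open>w\<close> rather than with the maximiser for
  \<open>s\<^sub>K\<close>, because a run of \<open>K\<close> iterations does not contain \<open>v\<^sub>K\<^sub>+\<^sub>1\<close>.
\<close>

lemma potential_decrease:
  fixes X :: "'a::real_inner set"
  assumes E: "subspace E" "X \<subseteq> E" and X: "bounded X" "convex X" and p: "p \<ge> 1"
    and F: "order_smooth E (p - 1) L F"
    and run: "perseus_iterates E X F p L x0 K x v s lam"
    and "k \<le> K" "w \<in> X"
  shows "inner (s k) (w - x0) - (norm (w - x0))\<^sup>2 / 2
      + (\<Sum>i=1..k. lam i * inner (F (x i)) (x i - x0)) + (\<Sum>i=1..k. (norm (x i - v i))\<^sup>2 / 8) \<le> 0"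
  using assms(8-9)
proof (induction k arbitrary: w)
  case 0
  then show ?case using run by (simp add: perseus_iterates_def)
next
  case (Suc k)
  let ?x = "x (Suc k)" and ?v = "v (Suc k)" and ?l = "lam (Suc k)"
  have step: "perseus_step E X F p L x0 (s k) ?v ?x" and l: "0 < ?l"
    "1 / (20 * real p - 8) \<le> ?l * L * norm (?x - ?v) ^ (p - 1) / fact p"
    "?l * L * norm (?x - ?v) ^ (p - 1) / fact p \<le> 1 / (10 * real p + 2)"
    and s: "s (Suc k) = s k - ?l *\<^sub>R F ?x"
    using run Suc.prems by (auto simp: perseus_iterates_def)
  have max: "is_arg_max (\<lambda>w. inner (s k) (w - x0) - (norm (w - x0))\<^sup>2 / 2) (\<lambda>w. w \<in> X) ?v"
    and x: "?x \<in> X" and sub: "res X (reg_taylor E F p L ?v) ?x \<le> L / fact p * norm (?x - ?v) ^ (p + 1)"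
    using step by (auto simp: perseus_step_def)
  have v: "?v \<in> X" using max by (simp add: is_arg_max_def)
  have "?l * inner (F ?x) (?x - w) - (norm (w - ?v))\<^sup>2 / 2 \<le> - (norm (?x - ?v))\<^sup>2 / 8"
    using step_decrease [OF E X(1) p F v x sub Suc.prems(2) l] .
  moreover have "inner (s k) (w - x0) - (norm (w - x0))\<^sup>2 / 2
    \<le> inner (s k) (?v - x0) - (norm (?v - x0))\<^sup>2 / 2 - (norm (w - ?v))\<^sup>2 / 2"
    using prox_argmax_quadratic_growth [OF X(2) max Suc.prems(2)] .
  moreover have "inner (s k) (?v - x0) - (norm (?v - x0))\<^sup>2 / 2
      + (\<Sum>i=1..k. lam i * inner (F (x i)) (x i - x0)) + (\<Sum>i=1..k. (norm (x i - v i))\<^sup>2 / 8) \<le> 0"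
    using Suc.IH [OF _ v] Suc.prems by simp
  moreover have "inner (s (Suc k)) (w - x0) + ?l * inner (F ?x) (?x - x0)
      = inner (s k) (w - x0) + ?l * inner (F ?x) (?x - w)"
    by (simp add: s inner_diff_left inner_diff_right algebra_simps)
  ultimately show ?case by simp
qed

text \<open>
  At the Minty point \<open>xs\<close> the linear part of the potential is \<open>\<Sum> \<lambda>\<^sub>i \<langle>F(x\<^sub>i), x\<^sub>i - xs\<rangle> \<ge> 0\<close>.
\<close>

lemma sum_step_lengths_le:
  fixes X :: "'a::real_inner set"
  assumes E: "subspace E" "X \<subseteq> E" and X: "bounded X" "convex X" and p: "p \<ge> 1"
    and F: "order_smooth E (p - 1) L F"
    and run: "perseus_iterates E X F p L x0 K x v s lam"
    and x0: "x0 \<in> X" and xs: "xs \<in> X" and minty: "\<And>x. x \<in> X \<Longrightarrow> inner (F x) (x - xs) \<ge> 0"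
  shows "(\<Sum>i=1..K. (norm (x i - v i))\<^sup>2) \<le> 4 * (diameter X)\<^sup>2"
proof -
  have s: "s k = - (\<Sum>i=1..k. lam i *\<^sub>R F (x i))" if "k \<le> K" for k
    using that
  proof (induction k)
    case 0
    then show ?case using run by (simp add: perseus_iterates_def)
  next
    case (Suc k)
    then have "s (Suc k) = s k - lam (Suc k) *\<^sub>R F (x (Suc k))"
      using run by (simp add: perseus_iterates_def)
    with Suc show ?case by simp
  qed
  have nonneg: "0 \<le> lam i * inner (F (x i)) (x i - xs)" if i: "i \<in> {1..K}" for i
  proof -
    obtain k where "i = Suc k" "k < K" using i by (cases i) auto
    then have "x i \<in> X" "0 < lam i"
      using run by (auto simp: perseus_iterates_def perseus_step_def)
    then show ?thesis using minty by simp
  qed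
  have "inner (s K) (xs - x0) = - (\<Sum>i=1..K. lam i * inner (F (x i)) (xs - x0))"
    by (simp only: s order_refl inner_minus_left inner_sum_left inner_scaleR_left)
  moreover have "lam i * inner (F (x i)) (x i - xs)
      = lam i * inner (F (x i)) (x i - x0) - lam i * inner (F (x i)) (xs - x0)" for i
    by (simp add: inner_diff_right algebra_simps)
  ultimately have "inner (s K) (xs - x0) + (\<Sum>i=1..K. lam i * inner (F (x i)) (x i - x0))
      = (\<Sum>i=1..K. lam i * inner (F (x i)) (x i - xs))"
    by (simp only: sum_subtractf)
  moreover have "0 \<le> (\<Sum>i=1..K. lam i * inner (F (x i)) (x i - xs))"
    using nonneg by (rule sum_nonneg)
  moreover have "inner (s K) (xs - x0) - (norm (xs - x0))\<^sup>2 / 2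
      + (\<Sum>i=1..K. lam i * inner (F (x i)) (x i - x0)) + (\<Sum>i=1..K. (norm (x i - v i))\<^sup>2 / 8) \<le> 0"
    using potential_decrease [OF E X p F run _ xs] by simp
  moreover have "(norm (xs - x0))\<^sup>2 \<le> (diameter X)\<^sup>2"
    using diameter_bounded_bound [OF X(1) xs x0] by (simp add: dist_norm power_mono)
  moreover have "(\<Sum>i=1..K. (norm (x i - v i))\<^sup>2 / 8) = (\<Sum>i=1..K. (norm (x i - v i))\<^sup>2) / 8"
    by (simp add: sum_divide_distrib)
  ultimately show ?thesis by linarith
qed

lemma min_step_length_le:
  fixes X :: "'a::real_inner set"
  assumes E: "subspace E" "X \<subseteq> E" and X: "bounded X" "convex X" and p: "p \<ge> 1"
    and F: "order_smooth E (p - 1) L F"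
    and run: "perseus_iterates E X F p L x0 T x v s lam"
    and x0: "x0 \<in> X" and xs: "xs \<in> X" and minty: "\<And>x. x \<in> X \<Longrightarrow> inner (F x) (x - xs) \<ge> 0"
    and min: "is_arg_min (\<lambda>k. norm (x k - v k)) (\<lambda>k. k \<in> {1..T}) k"
  shows "norm (x k - v k) \<le> 2 * diameter X / sqrt (real T)"
proof -
  have k: "k \<in> {1..T}" and least: "\<And>i. i \<in> {1..T} \<Longrightarrow> norm (x k - v k) \<le> norm (x i - v i)"
    using min by (auto simp: is_arg_min_def not_less)
  have T: "0 < real T" using k by auto
  have "real T * (norm (x k - v k))\<^sup>2 = (\<Sum>i=1..T. (norm (x k - v k))\<^sup>2)" by simp
  also have "\<dots> \<le> (\<Sum>i=1..T. (norm (x i - v i))\<^sup>2)"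
    by (intro sum_mono power_mono least) auto
  also have "\<dots> \<le> 4 * (diameter X)\<^sup>2"
    by (rule sum_step_lengths_le [OF E X p F run x0 xs minty])
  finally have "(norm (x k - v k))\<^sup>2 \<le> (2 * diameter X / sqrt (real T))\<^sup>2"
    using T by (simp add: power_divide power_mult_distrib field_simps)
  then show ?thesis
    by (rule power2_le_imp_le) (simp add: diameter_ge_0 X)
qed

section \<open>The complexity bound\<close>

lemma perseus_output_residual:
  fixes X :: "'a::real_inner set"
  assumes E: "subspace E" "X \<subseteq> E" and X: "bounded X" "convex X" and p: "p \<ge> 1" and L: "L > 0"
    and F: "order_smooth E (p - 1) L F"
    and x0: "x0 \<in> X" and xs: "xs \<in> X" and minty: "\<And>x. x \<in> X \<Longrightarrow> inner (F x) (x - xs) \<ge> 0"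
    and out: "perseus E X F p L x0 T y n"
  shows "res X F y \<le> (5 * real p + 2) / fact p * L * diameter X * (2 * diameter X / sqrt (real T)) ^ p
    \<and> (n = T \<or> n < T \<and> vi_solution X F y)"
    (is "res X F y \<le> ?b \<and> _")
proof -
  have D: "0 \<le> diameter X" using X(1) by (rule diameter_ge_0)
  have b: "0 \<le> ?b" using L D by simp
  show ?thesis
    using out
  proof cases
    case (stop_solution x v s lam)
    then have "y \<in> X" by (simp add: vi_solution_def)
    with stop_solution have "res X F y \<le> 0"
      using vi_solution_iff_res [OF X(1)] by auto
    then show ?thesis using b stop_solution by auto
  next
    case (stop_fixed_point k x v s lam w)
    then have "w \<in> X" "y \<in> X"
      and "res X (reg_taylor E F p L w) y \<le> L / fact p * norm (y - w) ^ (p + 1)"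
      by (auto simp: perseus_step_def is_arg_max_def)
    \<comment> \<open>The step has length zero, so the residual estimate makes \<open>y\<close> an exact solution.\<close>
    then have "res X F y \<le> 0"
      using residual_le_step_length [OF E X(1) p L F, of w y] stop_fixed_point
      by (simp add: power_0_left)
    moreover have "vi_solution X F y"
      using calculation vi_solution_iff_res [OF X(1) \<open>y \<in> X\<close>] by blast
    moreover have "n = T \<or> n < T" using stop_fixed_point by auto
    ultimately show ?thesis using b by auto
  next
    case (finish x v s lam k)
    then have k: "k \<in> {1..T}" by (auto simp: is_arg_min_def)
    then obtain i where "k = Suc i" "i < T" by (cases k) auto
    then have step: "perseus_step E X F p L x0 (s i) (v k) (x k)"
      using finish by (auto simp: perseus_iterates_def)
    then have "res X F (x k) \<le> (5 * real p + 2) / fact p * L * diameter X * norm (x k - v k) ^ p"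
      by (intro residual_le_step_length [OF E X(1) p L F]) (auto simp: perseus_step_def is_arg_max_def)
    also have "\<dots> \<le> ?b"
      using min_step_length_le [OF E X p F finish(3) x0 xs minty finish(4)] L D
      by (intro mult_left_mono power_mono) auto
    finally show ?thesis using finish by simp
  qed
qed

text \<open>
  \<open>T\<close> exceeds \<open>K\<^bsup>2/p\<^esup> a\<^bsup>2/p\<^esup>\<close>, where \<open>a = L D\<^bsup>p+1\<^esup>/\<epsilon>\<close> and \<open>K = 2\<^sup>p (5p+2)/p!\<close> collects the constants of
  the residual bound, so that \<open>K a \<le> T\<^bsup>p/2\<^esup>\<close>; rounding up costs at most \<open>2\<close>.
\<close>

theorem theorem3p7:
  fixes p :: nat
  assumes "p \<ge> 1"
  shows "\<exists>C::real. C > 0 \<and>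
    (\<forall>L D \<epsilon> :: real. L > 0 \<longrightarrow> D > 0 \<longrightarrow> 0 < \<epsilon> \<longrightarrow> \<epsilon> < 1 \<longrightarrow>
      (\<exists>T::nat. T \<ge> 1 \<and>
        real T \<le> C * max 1 ((L * D ^ (p + 1) / \<epsilon>) powr (2 / real p)) \<and>
        (\<forall>(d::nat) (X :: rseq set) (F :: rseq \<Rightarrow> rseq) (x0 :: rseq).
           X \<subseteq> Rd d \<longrightarrow> closed X \<longrightarrow> convex X \<longrightarrow> bounded X \<longrightarrow> diameter X = D \<longrightarrow>
           F \<in> Rd d \<rightarrow> Rd d \<longrightarrow> order_smooth (Rd d) (p - 1) L F \<longrightarrow>
           (\<exists>xs\<in>X. \<forall>x\<in>X. inner (F x) (x - xs) \<ge> 0) \<longrightarrow>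
           x0 \<in> X \<longrightarrow>
           (\<forall>xhat n. perseus (Rd d) X F p L x0 T xhat n \<longrightarrow>
              res X F xhat \<le> \<epsilon> \<and>
              (n = T \<or> n < T \<and> vi_solution X F xhat)))))"
proof -
  define K :: real where "K = 2 ^ p * (5 * real p + 2) / fact p"
  have K: "0 < K" by (simp add: K_def add_nonneg_pos)
  have *: "\<exists>T::nat. T \<ge> 1 \<and>
      real T \<le> (K powr (2 / real p) + 2) * max 1 ((L * D ^ (p + 1) / \<epsilon>) powr (2 / real p)) \<and>
      (5 * real p + 2) / fact p * L * D * (2 * D / sqrt (real T)) ^ p \<le> \<epsilon>"
    if L: "L > 0" and D: "D > 0" and \<epsilon>: "\<epsilon> > 0" for L D \<epsilon> :: real
  proof -
    define a where "a = L * D ^ (p + 1) / \<epsilon>"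
    have a: "0 < a" using L D \<epsilon> by (simp add: a_def)
    define z where "z = K powr (2 / real p) * a powr (2 / real p)"
    define T where "T = nat \<lceil>z\<rceil> + 1"
    have T1: "1 \<le> T" by (simp add: T_def)
    then have T: "0 < real T" by simp
    have "0 \<le> z" by (simp add: z_def)
    then have "z \<le> real T" "real T \<le> z + 2"
      unfolding T_def by linarith+
    then have ge: "K powr (2 / real p) * a powr (2 / real p) \<le> real T"
      and le: "real T \<le> K powr (2 / real p) * a powr (2 / real p) + 2"
      by (simp_all add: z_def)
    have T_le: "real T \<le> K powr (2 / real p) * max 1 (a powr (2 / real p)) + 2 * max 1 (a powr (2 / real p))"
      by (rule order_trans [OF le add_mono [OF mult_left_mono]]) auto
    have "K * a \<le> sqrt (real T) ^ p"
    proof -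
      have "K * a = ((K * a) powr (2 / real p)) powr (real p / 2)"
        using K a assms by (simp add: powr_powr)
      also have "\<dots> \<le> real T powr (real p / 2)"
        using ge K a by (intro powr_mono2) (auto simp: powr_mult)
      also have "\<dots> = (real T powr (1 / 2)) powr real p"
        by (simp only: powr_powr) simp
      also have "\<dots> = sqrt (real T) ^ p"
        using T by (simp add: powr_half_sqrt powr_realpow)
      finally show ?thesis .
    qed
    then have "K * a * \<epsilon> / sqrt (real T) ^ p \<le> sqrt (real T) ^ p * \<epsilon> / sqrt (real T) ^ p"
      using \<epsilon> by (intro divide_right_mono mult_right_mono) auto
    also have "\<dots> = \<epsilon>" using T by simp
    also have "K * a * \<epsilon> / sqrt (real T) ^ p = (5 * real p + 2) / fact p * L * D * (2 * D / sqrt (real T)) ^ p"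
      using \<epsilon> by (simp add: K_def a_def power_divide power_mult_distrib)
    finally have "(5 * real p + 2) / fact p * L * D * (2 * D / sqrt (real T)) ^ p \<le> \<epsilon>" .
    moreover have "real T \<le> (K powr (2 / real p) + 2) * max 1 ((L * D ^ (p + 1) / \<epsilon>) powr (2 / real p))"
      using T_le by (simp only: distrib_right a_def)
    ultimately show ?thesis
      using T1 by blast
  qed
  show ?thesis
  proof (intro exI [of _ "K powr (2 / real p) + 2"] conjI allI impI, goal_cases)
    case 1
    show ?case by (simp add: add_nonneg_pos)
  next
    case (2 L D \<epsilon>)
    from * [OF 2(1-3)] obtain T where T: "T \<ge> 1"
      "real T \<le> (K powr (2 / real p) + 2) * max 1 ((L * D ^ (p + 1) / \<epsilon>) powr (2 / real p))"
      "(5 * real p + 2) / fact p * L * D * (2 * D / sqrt (real T)) ^ p \<le> \<epsilon>"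
      by blast
    have main: "res X F xhat \<le> \<epsilon> \<and> (n = T \<or> n < T \<and> vi_solution X F xhat)"
      if run: "X \<subseteq> Rd d" "convex X" "bounded X" "diameter X = D" "order_smooth (Rd d) (p - 1) L F"
        "\<exists>xs\<in>X. \<forall>x\<in>X. inner (F x) (x - xs) \<ge> 0" "x0 \<in> X" "perseus (Rd d) X F p L x0 T xhat n"
      for d X F x0 xhat n
    proof -
      obtain xs where xs: "xs \<in> X" "\<And>x. x \<in> X \<Longrightarrow> inner (F x) (x - xs) \<ge> 0"
        using run(6) by blast
      show ?thesis
        using perseus_output_residual [OF subspace_Rd run(1,3,2) assms 2(1) run(5,7) xs run(8)] T(3)
        unfolding run(4) by linarith
    qed
    show ?case
      by (intro exI [of _ T] conjI T(1,2); intro allI impI; rule main; assumption)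
  qed
qed

end
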